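(* Let $K,L\in\mathcal{K}^n$, let $i$ be an integer with $0\le i<n$, and let $\phi\in\Phi$. Then $$A_{\phi,i}(K,L)\ge A_i(K)\cdot\phi\left(\left(\frac{A_i(L)}{A_i(K)}\right)^{1/(n-i)}\right).$$ If $\phi$ is strictly convex, equality holds if and only if $K$ and $L$ have similar width.
   Context: $\mathcal{K}^n$ is the class of convex bodies (compact convex sets with nonempty interior) in $\mathbb{R}^n$ containing the origin in their interiors. The support function is $h(K,x)=\max\{x\cdot y:y\in K\}$, and the half width of $K$ in direction $u\in S^{n-1}$ is $b(K,u)=\frac12(h(K,u)+h(K,-u))$. $K$ and $L$ have similar width if there is a constant $\lambda>0$ with $b(K,u)=\lambda b(L,u)$ for all $u\in S^{n-1}$. $dS$ is the surface area measure on the unit sphere $S^{n-1}$. For an integer $0\le i<n$ the width integral is $A_i(K)=\frac1n\int_{S^{n-1}}b(K,u)^{n-i}\,dS(u)$. $\Phi$ is the set of convex, strictly decreasing functions $\phi$ on $[0,\infty)$, with values in $(0,\infty)$ on $(0,\infty)$, such that $\phi(0)=\infty$, $\phi(1)=1$ and $\phi(\infty)=0$ (the values at $0$ and $\infty$ are understood as limits). For $\phi\in\Phi$, the Orlicz mixed width integral of $K,L\in\mathcal{K}^n$ is $$A_{\phi,i}(K,L)=\frac1n\int_{S^{n-1}}\phi\left(\frac{b(L,u)}{b(K,u)}\right)b(K,u)^{n-i}\,dS(u).$$ *)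

theory Defs
  imports "HOL-Analysis.Analysis"
begin

text \<open>Compact convex sets containing the origin in their interiors; in particular
  the interior is nonempty.\<close>

definition convex_bodies :: "(real ^ 'n) set set" where
  "convex_bodies = {K. compact K \<and> convex K \<and> 0 \<in> interior K}"

text \<open>For nonempty compact \<open>K\<close> the supremum is attained, hence a maximum.\<close>

definition support_function :: "(real ^ 'n) set \<Rightarrow> real ^ 'n \<Rightarrow> real" where
  "support_function K x = (SUP y\<in>K. x \<bullet> y)"

definition half_width :: "(real ^ 'n) set \<Rightarrow> real ^ 'n \<Rightarrow> real" where
  "half_width K u = (support_function K u + support_function K (- u)) / 2"

definition similar_width :: "(real ^ 'n) set \<Rightarrow> (real ^ 'n) set \<Rightarrow> bool" where
  "similar_width K L \<longleftrightarrow>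
    (\<exists>c>0. \<forall>u\<in>sphere 0 1. half_width K u = c * half_width L u)"

text \<open>The surface area measure on the Borel sets of the unit sphere in dimension \<open>n\<close>,
  defined by polar coordinates: the area of \<open>A\<close> is \<open>n\<close> times the volume of the cone of all
  \<open>x\<close> with \<open>0 < norm x \<le> 1\<close> and \<open>x /\<^sub>R norm x \<in> A\<close>
  (so that the volume of this cone is the integral over \<open>{0..1}\<close> of the area of \<open>A\<close> times
  \<open>r ^ (n - 1)\<close>). For \<open>n = 1\<close> this is the counting measure on \<open>{-1, 1}\<close>.\<close>

definition sphere_measure :: "(real ^ 'n) measure" where
  "sphere_measure =
    scale_measure (ennreal (real CARD('n)))
      (distr (restrict_space lborel (cball 0 1 - {0}))
             (restrict_space borel (sphere 0 1))
             (\<lambda>x. x /\<^sub>R norm x))"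

lemma space_sphere_measure: "space sphere_measure = sphere 0 1"
  by (simp add: sphere_measure_def space_restrict_space space_scale_measure)

lemma sets_sphere_measure: "sets sphere_measure = sets (restrict_space borel (sphere 0 1))"
  by (simp add: sphere_measure_def)

lemma emeasure_sphere_measure:
  fixes A :: "(real ^ 'n) set"
  assumes "A \<in> sets borel" "A \<subseteq> sphere 0 1"
  shows "emeasure sphere_measure A =
    ennreal (real CARD('n)) * emeasure lborel {x. 0 < norm x \<and> norm x \<le> 1 \<and> x /\<^sub>R norm x \<in> A}"
proof -
  let ?B = "cball 0 1 - {0} :: (real ^ 'n) set"
  let ?M = "restrict_space lborel ?B" and ?N = "restrict_space borel (sphere 0 1) :: (real ^ 'n) measure"
  let ?C = "{x. 0 < norm x \<and> norm x \<le> 1 \<and> x /\<^sub>R norm x \<in> A}"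
  have "(\<lambda>x. x /\<^sub>R norm x) \<in> borel_measurable ?M"
    by (rule measurable_restrict_space1) measurable
  then have m: "(\<lambda>x. x /\<^sub>R norm x) \<in> ?M \<rightarrow>\<^sub>M ?N"
    by (intro measurable_restrict_space2) (auto simp: space_restrict_space)
  have A: "A \<in> sets ?N"
    using assms by (simp add: sets_restrict_space_iff)
  have C: "(\<lambda>x. x /\<^sub>R norm x) -` A \<inter> space ?M = ?C"
    by (auto simp: space_restrict_space)
  have "emeasure (distr ?M ?N (\<lambda>x. x /\<^sub>R norm x)) A = emeasure ?M ?C"
    using emeasure_distr[OF m A] C by simp
  also have "\<dots> = emeasure lborel ?C"
    by (rule emeasure_restrict_space) auto
  finally show ?thesis
    by (simp add: sphere_measure_def)
qed

lemma emeasure_sphere_measure_sphere: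
  "emeasure (sphere_measure :: (real ^ 'n) measure) (sphere 0 1) =
    ennreal (real CARD('n) * unit_ball_vol (real CARD('n)))"
proof -
  have "{x :: real ^ 'n. 0 < norm x \<and> norm x \<le> 1 \<and> x /\<^sub>R norm x \<in> sphere 0 1} = cball 0 1 - {0}"
    by auto
  moreover have "emeasure lborel (cball 0 1 - {0 :: real ^ 'n}) = emeasure lborel (cball (0 :: real ^ 'n) 1)"
    by (rule emeasure_Diff_null_set) (auto simp: null_sets_def)
  moreover have "emeasure lborel (cball (0 :: real ^ 'n) 1) = ennreal (unit_ball_vol (real CARD('n)))"
    by (subst emeasure_cball) auto
  ultimately show ?thesis
    by (subst emeasure_sphere_measure) (simp_all add: ennreal_mult del: mem_sphere mem_sphere_0)
qed

definition width_integral :: "nat \<Rightarrow> (real ^ 'n) set \<Rightarrow> real" where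
  "width_integral i K =
    1 / real CARD('n) * (LINT u|sphere_measure. half_width K u ^ (CARD('n) - i))"

text \<open>The class \<open>\<Phi>\<close>. The values \<open>\<phi> 0 = \<infinity>\<close> and \<open>\<phi> \<infinity> = 0\<close> are limits, so only the
  values of \<open>\<phi>\<close> on \<open>{0<..}\<close> matter.\<close>

definition Phi :: "(real \<Rightarrow> real) set" where
  "Phi = {\<phi>. convex_on {0<..} \<phi> \<and> strict_antimono_on {0<..} \<phi> \<and> (\<forall>t>0. \<phi> t > 0) \<and>
    filterlim \<phi> at_top (at_right 0) \<and> \<phi> 1 = 1 \<and> (\<phi> \<longlongrightarrow> 0) at_top}"

definition strictly_convex_on :: "real set \<Rightarrow> (real \<Rightarrow> real) \<Rightarrow> bool" where
  "strictly_convex_on S f \<longleftrightarrow> convex S \<and>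
    (\<forall>x\<in>S. \<forall>y\<in>S. \<forall>t. x \<noteq> y \<and> 0 < t \<and> t < 1 \<longrightarrow>
      f ((1 - t) * x + t * y) < (1 - t) * f x + t * f y)"

definition orlicz_mixed_width_integral ::
    "(real \<Rightarrow> real) \<Rightarrow> nat \<Rightarrow> (real ^ 'n) set \<Rightarrow> (real ^ 'n) set \<Rightarrow> real" where
  "orlicz_mixed_width_integral \<phi> i K L =
    1 / real CARD('n) *
      (LINT u|sphere_measure.
        \<phi> (half_width L u / half_width K u) * half_width K u ^ (CARD('n) - i))"

end

theory Submission
  imports Defs
begin

text \<open>Write \<open>p = n - i\<close>, \<open>f = half_width L / half_width K\<close> and let \<open>c\<close> be the argument of \<open>\<phi>\<close> on
  the right-hand side. A supporting line of \<open>\<phi>\<close> at \<open>c\<close> has negative slope, and \<open>t - c\<close> is at most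
  \<open>(t ^ p - c ^ p) / (p * c ^ (p - 1))\<close>; together they give a constant \<open>s\<close> with
  \<open>\<phi> t \<ge> \<phi> c + s * (t ^ p - c ^ p)\<close> for all \<open>t > 0\<close>, strictly for \<open>t \<noteq> c\<close> if \<open>\<phi>\<close> is strictly
  convex. Put \<open>t = f u\<close>, multiply by \<open>half_width K u ^ p\<close> and integrate: the choice of \<open>c\<close> makes the
  term with \<open>s\<close> vanish, which is Jensen's and Hoelder's inequality in one step. In the case of
  equality a continuous nonnegative function has integral zero, hence it vanishes identically.\<close>

section \<open>Support functions and half widths\<close>

lemma bdd_above_inner:
  fixes K :: "'a::real_inner set"
  assumes "bounded K"
  shows "bdd_above ((\<lambda>y. x \<bullet> y) ` K)"
  using assms bounded_inner_imp_bdd_above by (metis (lifting) ext inner_commute)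

lemma support_function_upper:
  assumes "bounded K" "y \<in> K"
  shows "x \<bullet> y \<le> support_function K x"
  unfolding support_function_def using assms by (intro cSUP_upper bdd_above_inner)

text \<open>A supremum of linear functions is convex. Convexity serves to get continuity of the half
  width: a finite convex function on the whole space is continuous.\<close>

lemma convex_on_support_function:
  fixes K :: "(real ^ 'n) set"
  assumes "bounded K" "K \<noteq> {}"
  shows "convex_on UNIV (support_function K)"
proof (rule convex_onI)
  fix t :: real and x y :: "real ^ 'n" assume t: "0 < t" "t < 1"
  have "((1 - t) *\<^sub>R x + t *\<^sub>R y) \<bullet> z \<le> (1 - t) * support_function K x + t * support_function K y"
    if "z \<in> K" for z
    using t support_function_upper[OF assms(1) that]
    by (simp add: inner_add_left add_mono mult_left_mono)
  then show "support_function K ((1 - t) *\<^sub>R x + t *\<^sub>R y) \<le>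
      (1 - t) * support_function K x + t * support_function K y"
    unfolding support_function_def[of K "_ + _"] using assms(2) by (intro cSUP_least)
qed simp

lemma continuous_on_half_width:
  fixes K :: "(real ^ 'n) set"
  assumes "K \<in> convex_bodies"
  shows "continuous_on S (half_width K)"
proof -
  have "bounded K" "K \<noteq> {}"
    using assms interior_subset by (auto simp: convex_bodies_def compact_imp_bounded)
  then have c: "continuous_on UNIV (support_function K)"
    by (intro convex_on_continuous convex_on_support_function) auto
  show ?thesis
    unfolding half_width_def
    by (intro continuous_intros continuous_on_compose2[OF c]) auto
qed

text \<open>A ball around the origin lies in \<open>K\<close>, so \<open>K\<close> has a point that
  is a positive multiple of \<open>u\<close>.\<close>

lemma support_function_pos:
  fixes K :: "(real ^ 'n) set"
  assumes "K \<in> convex_bodies" "u \<noteq> 0"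
  shows "support_function K u > 0"
proof -
  obtain e where e: "e > 0" "cball 0 e \<subseteq> K"
    using assms by (auto simp: convex_bodies_def mem_interior_cball)
  have "bounded K"
    using assms by (auto simp: convex_bodies_def compact_imp_bounded)
  moreover have "(e / norm u) *\<^sub>R u \<in> K"
    using e assms(2) by (intro subsetD[OF e(2)]) simp
  ultimately have "u \<bullet> ((e / norm u) *\<^sub>R u) \<le> support_function K u"
    by (rule support_function_upper)
  moreover have "u \<bullet> ((e / norm u) *\<^sub>R u) > 0"
    using e assms(2) by simp
  ultimately show ?thesis by linarith
qed

lemma half_width_pos:
  assumes "K \<in> convex_bodies" "u \<noteq> 0"
  shows "half_width K u > 0"
  using support_function_pos[OF assms] support_function_pos[OF assms(1), of "- u"] assms(2)
  by (simp add: half_width_def)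

section \<open>Integrals of continuous functions over the sphere\<close>

lemma integrable_sphere_measure:
  fixes f :: "real ^ 'n \<Rightarrow> real"
  assumes "continuous_on (sphere 0 1) f"
  shows "integrable sphere_measure f"
proof -
  interpret finite_measure "sphere_measure :: (real ^ 'n) measure"
    by (rule finite_measureI) (simp add: space_sphere_measure emeasure_sphere_measure_sphere)
  have "bounded (f ` sphere 0 1)"
    using assms by (intro compact_imp_bounded compact_continuous_image) auto
  then obtain B where "\<And>u. u \<in> sphere 0 1 \<Longrightarrow> norm (f u) \<le> B"
    unfolding bounded_iff by blast
  moreover have "f \<in> borel_measurable sphere_measure"
    using borel_measurable_continuous_on_restrict[OF assms]
    by (simp add: measurable_cong_sets[OF sets_sphere_measure refl])
  ultimately show ?thesis
    by (intro integrable_const_bound[of _ B] AE_I2) (auto simp: space_sphere_measure)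
qed

text \<open>The cone over a nonempty relatively open subset of the sphere has nonempty interior, so that
  the surface area measure has full support.\<close>

lemma integral_sphere_measure_eq_0_imp:
  fixes f :: "real ^ 'n \<Rightarrow> real"
  assumes cont: "continuous_on (sphere 0 1) f"
    and nonneg: "\<And>u. u \<in> sphere 0 1 \<Longrightarrow> f u \<ge> 0"
    and int: "(LINT u|sphere_measure. f u) = 0"
    and v: "v \<in> sphere 0 1"
  shows "f v = 0"
proof (rule ccontr)
  assume "f v \<noteq> 0"
  let ?U = "{u \<in> sphere 0 1. f u \<noteq> 0}"
  \<comment> \<open>The part of the cone \<open>?C\<close> inside the open ball. Unlike
    \<open>?C\<close>, it is open in the whole space, so if nonempty it cannot be a null
    set.\<close>
  let ?V = "{x \<in> ball 0 1 - {0}. f (x /\<^sub>R norm x) \<noteq> 0}"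
  let ?C = "{x. 0 < norm x \<and> norm x \<le> 1 \<and> x /\<^sub>R norm x \<in> ?U}"
  have "AE u in sphere_measure. f u = 0"
    using int nonneg
    by (subst (asm) integral_nonneg_eq_0_iff_AE)
      (auto intro!: integrable_sphere_measure cont AE_I2 simp: space_sphere_measure)
  moreover have U: "?U \<in> sets sphere_measure"
    using borel_measurable_integrable[OF integrable_sphere_measure[OF cont]]
    by (auto simp: space_sphere_measure[symmetric] intro!: borel_measurable_neq)
  ultimately have "emeasure sphere_measure ?U = 0"
    by (subst (asm) AE_iff_measurable[OF U]) (auto simp: space_sphere_measure)
  moreover have "?U \<in> sets borel"
    using U by (subst (asm) sets_sphere_measure) (auto simp: sets_restrict_space_iff)
  ultimately have C: "emeasure lborel ?C = 0"
    by (subst (asm) emeasure_sphere_measure) auto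
  have unit: "x /\<^sub>R norm x \<in> sphere 0 1" if "x \<noteq> 0" for x :: "real ^ 'n"
    using that by simp
  have "continuous_on (ball 0 1 - {0}) (\<lambda>x. f (x /\<^sub>R norm x))"
  proof (rule continuous_on_compose2[OF cont])
    show "continuous_on (ball 0 1 - {0}) (\<lambda>x. x /\<^sub>R norm x)"
      by (intro continuous_intros) auto
  qed (use unit in blast)
  then have V: "open ?V"
    using continuous_open_preimage[of "ball 0 1 - {0}" "\<lambda>x. f (x /\<^sub>R norm x)" "- {0}"]
    by (auto simp: vimage_def Int_def)
  \<comment> \<open>The factor \<open>1 / 2\<close> moves \<open>v\<close> off the boundary of the
    ball and leaves its direction unchanged.\<close>
  have "(1 / 2) *\<^sub>R v \<in> ?V"
    using v \<open>f v \<noteq> 0\<close> by auto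
  then have "\<not> negligible ?V"
    using open_not_negligible[OF V] by blast
  moreover have "?V \<in> null_sets lborel"
  proof (rule null_sets_subset)
    \<comment> \<open>Measurability must be checked separately, because \<open>emeasure\<close> is
      also 0 on nonmeasurable sets. The cone is a Borel preimage under the radial
      projection.\<close>
    have "?C = ((\<lambda>x. x /\<^sub>R norm x) -` ?U \<inter> space borel) \<inter> (cball 0 1 - {0})"
      by auto
    also have "\<dots> \<in> sets borel"
      using \<open>?U \<in> sets borel\<close> by (intro sets.Int measurable_sets[of _ borel borel]) auto
    finally show "?C \<in> null_sets lborel"
      by (intro null_setsI C) (unfold sets_lborel)
    show "?V \<in> sets lborel"
      using V by simp
    show "?V \<subseteq> ?C"
    proof
      fix x assume "x \<in> ?V"
      then have "norm x < 1" "x \<noteq> 0" "f (x /\<^sub>R norm x) \<noteq> 0"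
        by auto
      then show "x \<in> ?C"
        using unit[of x] unfolding mem_Collect_eq by simp
    qed
  qed
  ultimately show False
    by (simp add: negligible_iff_null_sets null_sets_completionI)
qed

lemma integral_sphere_measure_pos:
  fixes f :: "real ^ 'n \<Rightarrow> real"
  assumes "continuous_on (sphere 0 1) f" "\<And>u. u \<in> sphere 0 1 \<Longrightarrow> f u > 0"
  shows "(LINT u|sphere_measure. f u) > 0"
proof -
  \<comment> \<open>The sphere is nonempty; \<open>undefined\<close> stands for an arbitrary
    coordinate.\<close>
  have "(axis undefined 1 :: real ^ 'n) \<in> sphere 0 1"
    by (simp add: norm_axis_1)
  then have "(LINT u|sphere_measure. f u) \<noteq> 0"
    using integral_sphere_measure_eq_0_imp[OF assms(1)] assms(2) by (metis less_le)
  moreover have "(LINT u|sphere_measure. f u) \<ge> 0"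
    using assms(2) by (intro integral_nonneg_AE AE_I2) (simp add: space_sphere_measure less_imp_le)
  ultimately show ?thesis by simp
qed

section \<open>Inequalities for convex functions of one variable\<close>

text \<open>This is Bernoulli's inequality at \<open>t / c - 1\<close>, which exceeds
  \<open>-1\<close>, scaled by \<open>c ^ p\<close>.\<close>

lemma power_above_tangent:
  fixes c t :: real
  assumes "c > 0" "t > 0"
  shows "real p * c ^ (p - 1) * (t - c) \<le> t ^ p - c ^ p"
proof (cases p)
  case (Suc q)
  have "1 + real p * (t / c - 1) \<le> (1 + (t / c - 1)) ^ p"
    using assms by (intro Bernoulli_inequality) auto
  then have "c ^ p * (1 + real p * (t / c - 1)) \<le> c ^ p * (t / c) ^ p"
    using assms by simp
  moreover have "c ^ p * (1 + real p * (t / c - 1)) = c ^ p + real p * c ^ (p - 1) * (t - c)"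
    using assms Suc by (simp add: field_simps)
  moreover have "c ^ p * (t / c) ^ p = t ^ p"
    using assms by (simp add: power_divide)
  ultimately show ?thesis by linarith
qed simp

lemma convex_antimono_supporting_line:
  fixes \<phi> :: "real \<Rightarrow> real"
  assumes "convex_on {0<..} \<phi>" "strict_antimono_on {0<..} \<phi>" "c > 0"
  obtains s where "s < 0" "\<And>t. t > 0 \<Longrightarrow> \<phi> t \<ge> \<phi> c + s * (t - c)"
    "\<And>t. strictly_convex_on {0<..} \<phi> \<Longrightarrow> t > 0 \<Longrightarrow> t \<noteq> c \<Longrightarrow> \<phi> t > \<phi> c + s * (t - c)"
proof -
  obtain s where line: "\<And>t. t > 0 \<Longrightarrow> \<phi> t \<ge> \<phi> c + s * (t - c)"
    using convex_le_Inf_differential[OF assms(1), of c] assms(3)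
    by (auto simp: interior_open)
  \<comment> \<open>Any point to the right of \<open>c\<close> would do: the line lies below \<phi>,
    which decreases, so its slope is negative.\<close>
  have "\<phi> (c + 1) < \<phi> c"
    using assms(2,3) by (intro monotone_onD[OF assms(2)]) auto
  then have "s < 0"
    using line[of "c + 1"] assms(3) by simp
  moreover have "\<phi> t > \<phi> c + s * (t - c)"
    if "strictly_convex_on {0<..} \<phi>" "t > 0" "t \<noteq> c" for t
  proof -
    \<comment> \<open>At the midpoint of \<open>c\<close> and \<open>t\<close>, \<phi> is strictly
      below the chord and not below the line. Since chord and line agree at \<open>c\<close>, the
      chord is strictly above the line at \<open>t\<close>.\<close>
    have "\<phi> ((1 - 1 / 2) * c + 1 / 2 * t) < (1 - 1 / 2) * \<phi> c + 1 / 2 * \<phi> t"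
      using that assms(3) unfolding strictly_convex_on_def
      by (elim conjE ballE[of _ _ c] ballE[of _ _ t] allE[of _ "1 / 2"]) auto
    moreover have "\<phi> ((1 - 1 / 2) * c + 1 / 2 * t) \<ge> \<phi> c + s * ((1 - 1 / 2) * c + 1 / 2 * t - c)"
      using that assms(3) by (intro line) simp
    ultimately show ?thesis by (simp add: algebra_simps)
  qed
  ultimately show ?thesis using line that by blast
qed

lemma convex_antimono_power_minorant:
  fixes \<phi> :: "real \<Rightarrow> real"
  assumes "convex_on {0<..} \<phi>" "strict_antimono_on {0<..} \<phi>" "c > 0" "p > 0"
  obtains s where "\<And>t. t > 0 \<Longrightarrow> \<phi> t \<ge> \<phi> c + s * (t ^ p - c ^ p)"
    "\<And>t. strictly_convex_on {0<..} \<phi> \<Longrightarrow> t > 0 \<Longrightarrow> t \<noteq> c \<Longrightarrow> \<phi> t > \<phi> c + s * (t ^ p - c ^ p)"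
proof -
  obtain r where r: "r < 0" "\<And>t. t > 0 \<Longrightarrow> \<phi> t \<ge> \<phi> c + r * (t - c)"
    "\<And>t. strictly_convex_on {0<..} \<phi> \<Longrightarrow> t > 0 \<Longrightarrow> t \<noteq> c \<Longrightarrow> \<phi> t > \<phi> c + r * (t - c)"
    using convex_antimono_supporting_line[OF assms(1-3)] by blast
  \<comment> \<open>With this \<open>s\<close> the function \<open>s * (t ^ p - c ^ p)\<close> has
    slope \<open>r\<close> at \<open>c\<close>. As \<open>s \<le> 0\<close>, it is concave and so
    lies below its tangent \<open>r * (t - c)\<close>.\<close>
  define s where "s = r / (real p * c ^ (p - 1))"
  have le: "s * (t ^ p - c ^ p) \<le> r * (t - c)" if "t > 0" for t
  proof -
    have "s \<le> 0"
      using r(1) assms(3,4) by (simp add: s_def divide_le_0_iff)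
    then have "s * (t ^ p - c ^ p) \<le> s * (real p * c ^ (p - 1) * (t - c))"
      using power_above_tangent[OF assms(3) that] by (rule mult_left_mono_neg[rotated])
    then show ?thesis
      using assms(3,4) by (simp add: s_def)
  qed
  show ?thesis
  proof (rule that[of s])
    show "\<phi> t \<ge> \<phi> c + s * (t ^ p - c ^ p)" if "t > 0" for t
      using r(2)[OF that] le[OF that] by linarith
    show "\<phi> t > \<phi> c + s * (t ^ p - c ^ p)" if "strictly_convex_on {0<..} \<phi>" "t > 0" "t \<noteq> c" for t
      using r(3)[OF that] le[OF that(2)] by linarith
  qed
qed

section \<open>Similar width and the Orlicz inequality\<close>

text \<open>Restates similarity through the quotient that is the argument of \<phi>; the constants
  on the two sides are reciprocal.\<close>

lemma similar_width_iff_quotient_const: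
  fixes K L :: "(real ^ 'n) set"
  assumes "K \<in> convex_bodies" "L \<in> convex_bodies"
  shows "similar_width K L \<longleftrightarrow> (\<exists>d>0. \<forall>u\<in>sphere 0 1. half_width L u / half_width K u = d)"
proof -
  have *: "half_width K u = d * half_width L u \<longleftrightarrow> half_width L u / half_width K u = 1 / d"
    if "u \<in> sphere 0 1" "d > 0" for u d
  proof -
    have "u \<noteq> 0" using that by auto
    then show ?thesis
      using half_width_pos[OF assms(1), of u] half_width_pos[OF assms(2), of u] that(2)
      by (auto simp: divide_simps mult.commute)
  qed
  show ?thesis
  proof
    assume "similar_width K L"
    then obtain d where "d > 0" "\<forall>u\<in>sphere 0 1. half_width K u = d * half_width L u"
      unfolding similar_width_def by blast
    then show "\<exists>d>0. \<forall>u\<in>sphere 0 1. half_width L u / half_width K u = d"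
      using * by (intro exI[of _ "1 / d"]) auto
  next
    assume "\<exists>d>0. \<forall>u\<in>sphere 0 1. half_width L u / half_width K u = d"
    then obtain d where "d > 0" "\<forall>u\<in>sphere 0 1. half_width L u / half_width K u = d"
      by blast
    then show "similar_width K L"
      unfolding similar_width_def using *[of _ "1 / d"] by (intro exI[of _ "1 / d"]) auto
  qed
qed

theorem theorem5p4:
  fixes K L :: "(real ^ 'n) set" and i :: nat and \<phi> :: "real \<Rightarrow> real"
  assumes "K \<in> convex_bodies" and "L \<in> convex_bodies"
    and "i < CARD('n)" and "\<phi> \<in> Phi"
  shows "orlicz_mixed_width_integral \<phi> i K L \<ge>
      width_integral i K *
        \<phi> ((width_integral i L / width_integral i K) powr (1 / real (CARD('n) - i))) \<and>
    (strictly_convex_on {0<..} \<phi> \<longrightarrow>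
      (orlicz_mixed_width_integral \<phi> i K L =
         width_integral i K *
           \<phi> ((width_integral i L / width_integral i K) powr (1 / real (CARD('n) - i)))
       \<longleftrightarrow> similar_width K L))"
proof -
  define n p where "n = real CARD('n)" and "p = CARD('n) - i"
  define w where "w u = half_width K u ^ p" for u
  define f where "f u = half_width L u / half_width K u" for u
  define c where "c = (width_integral i L / width_integral i K) powr (1 / real p)"
  let ?I = "\<lambda>g. LINT u|sphere_measure. g u :: real"
  have p: "p > 0" and n: "n > 0"
    using assms(3) by (auto simp: p_def n_def)
  have \<phi>: "convex_on {0<..} \<phi>" "strict_antimono_on {0<..} \<phi>"
    using assms(4) by (auto simp: Phi_def)
  have K: "half_width K u > 0" and L: "half_width L u > 0" if "u \<in> sphere 0 1" for u
    using that assms(1,2) by (auto intro!: half_width_pos)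
  have f: "f u > 0" and w: "w u > 0" and fw: "f u ^ p * w u = half_width L u ^ p"
    if "u \<in> sphere 0 1" for u
    using K[OF that] L[OF that] by (auto simp: f_def w_def power_divide)
  have cont_w: "continuous_on (sphere 0 1) w"
    unfolding w_def by (intro continuous_intros continuous_on_half_width assms)
  have cont_f: "continuous_on (sphere 0 1) f"
    unfolding f_def using K
    by (intro continuous_on_divide continuous_on_half_width assms) (metis less_irrefl)
  have "continuous_on {0<..} \<phi>"
    by (rule convex_on_continuous) (use \<phi> in auto)
  then have cont_\<phi>: "continuous_on (sphere 0 1) (\<lambda>u. \<phi> (f u))"
    by (rule continuous_on_compose2[OF _ cont_f]) (use f in auto)
  have A_K: "n * width_integral i K = ?I w"
    using n by (simp add: width_integral_def n_def w_def p_def)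
  have A_L: "n * width_integral i L = ?I (\<lambda>u. f u ^ p * w u)"
  proof -
    have "?I (\<lambda>u. f u ^ p * w u) = ?I (\<lambda>u. half_width L u ^ p)"
      by (intro Bochner_Integration.integral_cong refl fw) (simp add: space_sphere_measure)
    then show ?thesis
      using n by (simp add: width_integral_def n_def p_def)
  qed
  have A_mix: "n * orlicz_mixed_width_integral \<phi> i K L = ?I (\<lambda>u. \<phi> (f u) * w u)"
    using n by (simp add: orlicz_mixed_width_integral_def n_def p_def f_def w_def)
  have Iw: "?I w > 0"
    by (intro integral_sphere_measure_pos cont_w w)
  have "?I (\<lambda>u. f u ^ p * w u) > 0"
    using f w by (intro integral_sphere_measure_pos continuous_intros cont_w cont_f) simp
  then have quot: "width_integral i L / width_integral i K = ?I (\<lambda>u. f u ^ p * w u) / ?I w"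
    "width_integral i L / width_integral i K > 0"
    using n Iw unfolding A_K[symmetric] A_L[symmetric] by (auto simp: zero_less_mult_iff)
  \<comment> \<open>Since \<open>0 powr x = 0\<close>, this rests on the quotient being nonzero. It
    places \<open>c\<close> in the interval where \<phi> is convex.\<close>
  have c: "c > 0"
    using quot(2) unfolding c_def by (metis less_irrefl powr_gt_zero)
  have "c ^ p = width_integral i L / width_integral i K"
    using quot(2) c p unfolding c_def by (simp add: powr_powr flip: powr_realpow abs_divide)
  \<comment> \<open>So \<open>c ^ p\<close> is the mean of \<open>f u ^ p\<close> with weight
    \<open>w\<close>.\<close>
  then have cp: "c ^ p * ?I w = ?I (\<lambda>u. f u ^ p * w u)"
    using quot(1) Iw by simp
  obtain s where s: "\<And>t. t > 0 \<Longrightarrow> \<phi> t \<ge> \<phi> c + s * (t ^ p - c ^ p)"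
    "\<And>t. strictly_convex_on {0<..} \<phi> \<Longrightarrow> t > 0 \<Longrightarrow> t \<noteq> c \<Longrightarrow> \<phi> t > \<phi> c + s * (t ^ p - c ^ p)"
    using convex_antimono_power_minorant[OF \<phi> c p] by blast
  \<comment> \<open>The weighted gap between \<phi> and its minorant; its integral is
    \<open>n\<close> times the deficit in the claimed inequality.\<close>
  define g where "g u = (\<phi> (f u) - \<phi> c - s * (f u ^ p - c ^ p)) * w u" for u
  have cont_g: "continuous_on (sphere 0 1) g"
    unfolding g_def by (intro continuous_intros cont_\<phi> cont_f cont_w)
  have g: "g u \<ge> 0" if "u \<in> sphere 0 1" for u
    using s(1)[OF f[OF that]] w[OF that] by (simp add: g_def)
  have int: "integrable sphere_measure (\<lambda>u. \<phi> (f u) * w u)" "integrable sphere_measure w"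
    "integrable sphere_measure (\<lambda>u. f u ^ p * w u)"
    by (intro integrable_sphere_measure continuous_intros cont_\<phi> cont_f cont_w)+
  have "?I g = ?I (\<lambda>u. \<phi> (f u) * w u - \<phi> c * w u - s * (f u ^ p * w u - c ^ p * w u))"
    by (simp add: g_def algebra_simps)
  also have "\<dots> = ?I (\<lambda>u. \<phi> (f u) * w u) - \<phi> c * ?I w - s * (?I (\<lambda>u. f u ^ p * w u) - c ^ p * ?I w)"
    using int by simp
  also have "\<dots> = ?I (\<lambda>u. \<phi> (f u) * w u) - \<phi> c * ?I w"
    by (simp add: cp)
  finally have Ig: "?I g = n * (orlicz_mixed_width_integral \<phi> i K L - width_integral i K * \<phi> c)"
    unfolding A_mix[symmetric] A_K[symmetric] by (simp add: algebra_simps)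
  have "?I g \<ge> 0"
    using g by (intro integral_nonneg_AE AE_I2) (simp add: space_sphere_measure)
  then have ineq: "orlicz_mixed_width_integral \<phi> i K L \<ge> width_integral i K * \<phi> c"
    using Ig n by (simp add: zero_le_mult_iff)
  have "orlicz_mixed_width_integral \<phi> i K L = width_integral i K * \<phi> c \<longleftrightarrow> similar_width K L"
    if strict: "strictly_convex_on {0<..} \<phi>"
  proof
    assume "orlicz_mixed_width_integral \<phi> i K L = width_integral i K * \<phi> c"
    then have "?I g = 0"
      using Ig by simp
    then have g0: "g u = 0" if "u \<in> sphere 0 1" for u
      using integral_sphere_measure_eq_0_imp[OF cont_g g _ that] by blast
    have "f u = c" if "u \<in> sphere 0 1" for u
    proof (rule ccontr)
      assume "f u \<noteq> c"
      then show False
        using s(2)[OF strict f[OF that]] g0[OF that] w[OF that] by (simp add: g_def)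
    qed
    then show "similar_width K L"
      using c by (auto simp: similar_width_iff_quotient_const[OF assms(1,2)] f_def)
  next
    assume "similar_width K L"
    then obtain d where d: "d > 0" "\<And>u. u \<in> sphere 0 1 \<Longrightarrow> f u = d"
      by (auto simp: similar_width_iff_quotient_const[OF assms(1,2)] f_def)
    \<comment> \<open>A constant quotient \<open>d\<close> must equal its own mean \<open>c\<close>,
      and at \<open>c\<close> the minorant touches \<phi>, so \<open>g\<close> vanishes on the
      sphere.\<close>
    have "?I (\<lambda>u. f u ^ p * w u) = ?I (\<lambda>u. d ^ p * w u)"
      using d(2) by (intro Bochner_Integration.integral_cong) (simp_all add: space_sphere_measure)
    then have "c ^ p = d ^ p"
      using cp Iw by simp
    then have "c = d"
      using c d(1) p by (meson less_imp_le power_eq_imp_eq_base)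
    then have "?I g = 0"
      using d(2) by (intro integral_eq_zero_AE AE_I2) (simp add: space_sphere_measure g_def)
    then show "orlicz_mixed_width_integral \<phi> i K L = width_integral i K * \<phi> c"
      using Ig n by simp
  qed
  then show ?thesis
    using ineq unfolding c_def p_def by blast
qed

end
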